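(* Consider a one-sided exchange economy with agents $N=\{1,\dots,n\}$ and a finite set of goods $M=M_1\cup\dots\cup M_n$ (disjoint endowments, $M_i$ owned by agent $i$), where every agent's valuation $v_i$ is a binary assignment valuation. Then the weak core is nonempty.
   Context: A valuation $v$ on subsets of $M$ is a binary assignment valuation if there exist a finite set of positions $J$ and a matrix $\alpha\in\{0,1\}^{M\times J}$ such that for every $X\subseteq M$, $v(X)=\max_{z}\sum_{g\in X}\sum_{j\in J}\alpha_{gj}z_{gj}$, where $z$ ranges over all assignments of elements of $X$ to elements of $J$, i.e. $z\in\{0,1\}^{X\times J}$ with each good assigned to at most one position and each position receiving at most one good. An allocation is a partition $M=M^*_1\cup\dots\cup M^*_n$ (agent $i$ receives $M_i^*$). A strongly blocking coalition for it is a nonempty $S\subseteq N$ together with a partition $\bigcup_{i\in S}M_i=\bigcup_{i\in S}M'_i$ such that $v_i(M'_i)>v_i(M^*_i)$ for all $i\in S$. The weak core is the set of allocations with no strongly blocking coalition. *)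

theory Defs
  imports Complex_Main
begin

definition is_assignment :: "'g set \<Rightarrow> nat set \<Rightarrow> ('g \<times> nat) set \<Rightarrow> bool" where
  "is_assignment X J Z \<longleftrightarrow> Z \<subseteq> X \<times> J \<and> inj_on fst Z \<and> inj_on snd Z"

text \<open>Binary assignment valuation on subsets of M (positions w.l.o.g. natural numbers).\<close>
definition binary_assignment_valuation :: "'g set \<Rightarrow> ('g set \<Rightarrow> real) \<Rightarrow> bool" where
  "binary_assignment_valuation M v \<longleftrightarrow>
     (\<exists>(J::nat set) (\<alpha>::'g \<Rightarrow> nat \<Rightarrow> real). finite J \<and>
        (\<forall>g\<in>M. \<forall>j\<in>J. \<alpha> g j \<in> {0, 1}) \<and>
        (\<forall>X. X \<subseteq> M \<longrightarrow>
            v X = Max {(\<Sum>(g,j)\<in>Z. \<alpha> g j) | Z. is_assignment X J Z}))"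

definition partition_among :: "'n set \<Rightarrow> 'g set \<Rightarrow> ('n \<Rightarrow> 'g set) \<Rightarrow> bool" where
  "partition_among S B A \<longleftrightarrow>
     (\<forall>i\<in>S. A i \<subseteq> B) \<and> (\<forall>i\<in>S. \<forall>k\<in>S. i \<noteq> k \<longrightarrow> A i \<inter> A k = {}) \<and>
     (\<Union>i\<in>S. A i) = B"

definition strongly_blocking ::
  "'n set \<Rightarrow> ('n \<Rightarrow> 'g set) \<Rightarrow> ('n \<Rightarrow> 'g set \<Rightarrow> real) \<Rightarrow> ('n \<Rightarrow> 'g set) \<Rightarrow> 'n set \<Rightarrow> bool" where
  "strongly_blocking N E v A S \<longleftrightarrow>
     S \<noteq> {} \<and> S \<subseteq> N \<and>
     (\<exists>A'. partition_among S (\<Union>i\<in>S. E i) A' \<and> (\<forall>i\<in>S. v i (A' i) > v i (A i)))"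

definition weak_core ::
  "'n set \<Rightarrow> 'g set \<Rightarrow> ('n \<Rightarrow> 'g set) \<Rightarrow> ('n \<Rightarrow> 'g set \<Rightarrow> real) \<Rightarrow> ('n \<Rightarrow> 'g set) \<Rightarrow> bool" where
  "weak_core N M E v A \<longleftrightarrow>
     partition_among N M A \<and> (\<nexists>S. strongly_blocking N E v A S)"

end

theory Submission
  imports Defs "HOL-Analysis.Brouwer_Fixpoint"
begin

text \<open>For real utility levels t and each pair c of a coalition S and a reallocation A of its
  endowment, put w c = 2 max(0, min over i in S of v i (A i) - t i). The total weight of the pairs
  whose coalition contains i is antitone in t, exceeds 1 where t i is low and vanishes where t i is
  high, so Kuhn's combinatorial lemma yields t at which all these totals are 1 up to a small error.
  Then w is an almost balanced family of weights on pairs that achieve the levels t, and averaging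
  their assignments shows that the rounded-up levels satisfy Hall's condition for the grand
  coalition: being a comparison of integers, the condition absorbs the error. Since every w c is
  less than 2, no coalition can raise all its members by 1 above t, and hence, values being
  integers, none can strongly block the resulting allocation.\<close>

section \<open>Balanced weights\<close>

lemma antitone_approximate_zero:
  fixes F :: "('n \<Rightarrow> real) \<Rightarrow> 'n \<Rightarrow> real"
  assumes fin: "finite N" and ab: "a < b" and L: "0 < L" and e: "0 < \<epsilon>"
    and anti: "\<And>s t i. (\<And>j. j \<in> N \<Longrightarrow> s j \<le> t j) \<Longrightarrow> i \<in> N \<Longrightarrow> F t i \<le> F s i"
    and lower: "\<And>t i. i \<in> N \<Longrightarrow> t i = a \<Longrightarrow> 0 \<le> F t i"
    and upper: "\<And>t i. i \<in> N \<Longrightarrow> t i = b \<Longrightarrow> F t i < 0"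
    and lip: "\<And>t h i. i \<in> N \<Longrightarrow> 0 \<le> h \<Longrightarrow> F t i \<le> F (\<lambda>j. t j + h) i + L * h"
  obtains t where "\<And>i. i \<in> N \<Longrightarrow> 0 \<le> F t i" "\<And>i. i \<in> N \<Longrightarrow> F t i \<le> \<epsilon>"
proof -
  define n where "n = card N"
  obtain e where e_bij: "bij_betw e {..<n} N"
    using ex_bij_betw_nat_finite[OF fin] by (auto simp: n_def atLeast0LessThan)
  define k where "k = the_inv_into {..<n} e"
  have k: "k j < n" "e (k j) = j" if "j \<in> N" for j
    using bij_betwE[OF bij_betw_the_inv_into[OF e_bij]] that e_bij
    by (auto simp: k_def bij_betw_def f_the_inv_into_f)
  have ke: "k (e i) = i" "e i \<in> N" if "i < n" for i
    using e_bij that unfolding k_def bij_betw_def by (auto simp: the_inv_into_f_f)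
  obtain p :: nat where p: "p > L * (b - a) / \<epsilon>"
    using reals_Archimedean2 by blast
  have p0: "0 < p"
    using p ab L e by (smt (verit, best) divide_nonneg_pos mult_nonneg_nonneg of_nat_0_less_iff)
  define h where "h = (b - a) / p"
  have h0: "0 < h" using ab p0 by (simp add: h_def)
  have Lh: "L * h \<le> \<epsilon>"
    using p p0 e by (simp add: h_def field_simps)
  define T where "T x j = a + h * real (x (k j))" for x j
  define label where "label x i = (if 0 \<le> F (T x) (e i) then 0 else 1 :: nat)" for x i
  have lab0: "label x i = 0" if "i < n" "x i = 0" for x i
    using that lower[of "e i" "T x"] by (simp add: label_def T_def ke)
  have lab1: "label x i = 1" if "i < n" "x i = p" for x i
  proof -
    have "T x (e i) = b" using that p0 by (simp add: T_def ke h_def)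
    then show ?thesis using upper[of "e i" "T x"] that by (simp add: label_def ke)
  qed
  obtain q where q: "\<forall>i<n. \<exists>r s. (\<forall>j<n. q j \<le> r j \<and> r j \<le> q j + 1) \<and>
      (\<forall>j<n. q j \<le> s j \<and> s j \<le> q j + 1) \<and> label r i \<noteq> label s i"
    by (rule kuhn_lemma[OF p0, of n label]) (use lab0 lab1 in \<open>auto simp: label_def\<close>)
  have main: "0 \<le> F (T q) i \<and> F (T q) i \<le> \<epsilon>" if i: "i \<in> N" for i
  proof -
    obtain r s where rs: "\<forall>j<n. q j \<le> r j \<and> r j \<le> q j + 1"
        "\<forall>j<n. q j \<le> s j \<and> s j \<le> q j + 1" "label r (k i) \<noteq> label s (k i)"
      using q k(1)[OF i] by blast
    then obtain r s where r: "\<forall>j<n. q j \<le> r j" "label r (k i) = 0"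
        and s: "\<forall>j<n. s j \<le> q j + 1" "label s (k i) = 1"
      by (cases "label r (k i) = 0") (fastforce simp: label_def split: if_splits)+
    have "0 \<le> F (T r) i" using r i by (simp add: label_def k split: if_splits)
    also have "\<dots> \<le> F (T q) i"
      by (rule anti) (use r i k h0 in \<open>auto simp: T_def\<close>)
    finally have 1: "0 \<le> F (T q) i" .
    have "F (T q) i \<le> F (\<lambda>j. T q j + h) i + L * h"
      using lip[OF i] h0 by simp
    also have "F (\<lambda>j. T q j + h) i \<le> F (T s) i"
    proof (rule anti[OF _ i])
      fix j assume j: "j \<in> N"
      have "real (s (k j)) \<le> real (q (k j)) + 1"
        using s(1) k[OF j] by (metis of_nat_1 of_nat_add of_nat_mono)
      then have "h * real (s (k j)) \<le> h * (real (q (k j)) + 1)"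
        using h0 by simp
      then show "T s j \<le> T q j + h" by (simp add: T_def algebra_simps)
    qed
    also have "F (T s) i < 0" using s i by (simp add: label_def k split: if_splits)
    finally show ?thesis using 1 Lh by simp
  qed
  show ?thesis by (rule that[of "T q"]) (use main in auto)
qed

lemma undominated_levels_with_balanced_weights:
  fixes y :: "'c \<Rightarrow> 'n \<Rightarrow> real" and \<delta> :: real
  assumes N: "finite N" and C: "finite C"
    and S: "\<And>c. c \<in> C \<Longrightarrow> S c \<subseteq> N \<and> S c \<noteq> {}"
    and single: "\<And>i. i \<in> N \<Longrightarrow> \<exists>c\<in>C. S c = {i} \<and> 0 \<le> y c i"
    and d: "0 < \<delta>" "\<delta> < 1"
  obtains t w where "\<And>c. c \<in> C \<Longrightarrow> 0 \<le> w c"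
    and "\<And>i. i \<in> N \<Longrightarrow> 1 \<le> (\<Sum>c | c \<in> C \<and> i \<in> S c. w c)"
    and "\<And>i. i \<in> N \<Longrightarrow> (\<Sum>c | c \<in> C \<and> i \<in> S c. w c) \<le> 1 + \<delta>"
    and "\<And>c i. c \<in> C \<Longrightarrow> 0 < w c \<Longrightarrow> i \<in> S c \<Longrightarrow> t i < y c i"
    and "\<And>c. c \<in> C \<Longrightarrow> \<exists>i\<in>S c. y c i < t i + 1"
proof -
  define m where "m t c = Min ((\<lambda>i. y c i - t i) ` S c)" for t c
  have Sfin: "finite (S c)" "S c \<noteq> {}" if "c \<in> C" for c
    using S[OF that] N finite_subset by auto
  have m_le: "m t c \<le> y c i - t i" if "c \<in> C" "i \<in> S c" for t c i
    unfolding m_def using Sfin[OF that(1)] that by auto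
  have m_ge: "x \<le> m t c \<longleftrightarrow> (\<forall>i\<in>S c. x \<le> y c i - t i)" if "c \<in> C" for t c x
    unfolding m_def using Sfin[OF that] by auto
  define W where "W t c = 2 * max 0 (m t c)" for t c
  define F where "F t i = (\<Sum>c | c \<in> C \<and> i \<in> S c. W t c) - 1" for t i
  define K where "K = Max (insert 0 ((\<lambda>(c, i). y c i) ` (C \<times> N)))"
  have K: "y c i \<le> K" if "c \<in> C" "i \<in> N" for c i
    unfolding K_def using that N C by (intro Max_ge) auto
  have K0: "0 \<le> K" unfolding K_def using N C by (intro Max_ge) auto
  have "-1 < K" "0 < 2 * real (card C) + 1" using K0 by auto
  then obtain t where t: "\<And>i. i \<in> N \<Longrightarrow> 0 \<le> F t i" "\<And>i. i \<in> N \<Longrightarrow> F t i \<le> \<delta>"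
  proof (rule antitone_approximate_zero[OF N _ _ d(1), of "-1" K _ F])
    fix s t :: "'n \<Rightarrow> real" and i
    assume le: "\<And>j. j \<in> N \<Longrightarrow> s j \<le> t j" and "i \<in> N"
    have "m t c \<le> m s c" if "c \<in> C" for c
      unfolding m_ge[OF that]
    proof
      fix j assume "j \<in> S c"
      then show "m t c \<le> y c j - s j"
        using m_le[OF that, of j t] le[of j] S[OF that] by fastforce
    qed
    then show "F t i \<le> F s i"
      unfolding F_def W_def by (intro diff_right_mono sum_mono mult_left_mono max.mono) auto
  next
    fix t :: "'n \<Rightarrow> real" and i assume i: "i \<in> N" and ti: "t i = -1"
    obtain c where c: "c \<in> C" "S c = {i}" "0 \<le> y c i" using single[OF i] by blast
    have "1 \<le> m t c" using c ti by (simp add: m_ge)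
    then have "1 \<le> W t c" by (simp add: W_def)
    also have "\<dots> \<le> (\<Sum>c | c \<in> C \<and> i \<in> S c. W t c)"
      by (rule member_le_sum) (use c C in \<open>auto simp: W_def\<close>)
    finally show "0 \<le> F t i" by (simp add: F_def)
  next
    fix t :: "'n \<Rightarrow> real" and i assume i: "i \<in> N" and ti: "t i = K"
    have "W t c = 0" if "c \<in> C" "i \<in> S c" for c
      using m_le[OF that, of t] K[OF that(1) i] ti by (simp add: W_def)
    then show "F t i < 0" by (simp add: F_def)
  next
    fix t :: "'n \<Rightarrow> real" and h :: real and i assume h: "0 \<le> h"
    have W: "W t c \<le> W (\<lambda>j. t j + h) c + 2 * h" if "c \<in> C" for c
    proof -
      have "m t c - h \<le> m (\<lambda>j. t j + h) c"
        unfolding m_ge[OF that] using m_le[OF that, of _ t] by force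
      then show ?thesis using h by (simp add: W_def max_def)
    qed
    have "(\<Sum>c | c \<in> C \<and> i \<in> S c. W t c)
        \<le> (\<Sum>c | c \<in> C \<and> i \<in> S c. W (\<lambda>j. t j + h) c + 2 * h)"
      by (rule sum_mono) (use W in auto)
    also have "\<dots> = (\<Sum>c | c \<in> C \<and> i \<in> S c. W (\<lambda>j. t j + h) c)
        + real (card {c \<in> C. i \<in> S c}) * (2 * h)"
      by (simp add: sum.distrib)
    also have "real (card {c \<in> C. i \<in> S c}) * (2 * h) \<le> real (card C) * (2 * h)"
      by (intro mult_right_mono) (use h C in \<open>auto intro!: card_mono\<close>)
    finally show "F t i \<le> F (\<lambda>j. t j + h) i + (2 * real (card C) + 1) * h"
      using h by (simp add: F_def algebra_simps)
  qed auto
  show ?thesis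
  proof (rule that[of "W t" t])
    show "0 \<le> W t c" for c by (simp add: W_def)
    show "1 \<le> (\<Sum>c | c \<in> C \<and> i \<in> S c. W t c)" if "i \<in> N" for i
      using t(1)[OF that] by (simp add: F_def)
    show upper: "(\<Sum>c | c \<in> C \<and> i \<in> S c. W t c) \<le> 1 + \<delta>" if "i \<in> N" for i
      using t(2)[OF that] by (simp add: F_def)
    show "t i < y c i" if "c \<in> C" "0 < W t c" "i \<in> S c" for c i
      using m_le[OF that(1,3), of t] that(2) by (simp add: W_def max_def split: if_splits)
    show "\<exists>i\<in>S c. y c i < t i + 1" if c: "c \<in> C" for c
    proof (rule ccontr)
      assume "\<not> ?thesis"
      then have "1 \<le> m t c" unfolding m_ge[OF c] by force
      then have "2 \<le> W t c" by (simp add: W_def)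
      obtain i where i: "i \<in> S c" using Sfin[OF c] by blast
      have "W t c \<le> (\<Sum>c | c \<in> C \<and> i \<in> S c. W t c)"
        by (rule member_le_sum) (use c i C in \<open>auto simp: W_def\<close>)
      then show False using upper[of i] \<open>2 \<le> W t c\<close> i S[OF c] d by fastforce
    qed
  qed
qed

section \<open>Rounding fractional assignments\<close>

theorem hall_marriage:
  assumes "finite I" and "\<And>x. x \<in> I \<Longrightarrow> finite (\<Gamma> x)"
    and "\<And>P. P \<subseteq> I \<Longrightarrow> card P \<le> card (\<Union>x\<in>P. \<Gamma> x)"
  shows "\<exists>f. inj_on f I \<and> (\<forall>x\<in>I. f x \<in> \<Gamma> x)"
  using assms
proof (induction "card I" arbitrary: I \<Gamma> rule: less_induct)
  case less
  note IH = less.hyps and finI = less.prems(1) and fin\<Gamma> = less.prems(2) and hall = less.prems(3)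
  show ?case
  proof (cases "\<exists>Q. Q \<subset> I \<and> Q \<noteq> {} \<and> card (\<Union>x\<in>Q. \<Gamma> x) = card Q")
    case True
    then obtain Q where Q: "Q \<subset> I" "Q \<noteq> {}" "card (\<Union>x\<in>Q. \<Gamma> x) = card Q" by blast
    define U where "U = (\<Union>x\<in>Q. \<Gamma> x)"
    have finQ: "finite Q" using Q finI finite_subset by blast
    have finU: "finite U" unfolding U_def using finQ Q fin\<Gamma> by blast
    have "\<exists>f. inj_on f Q \<and> (\<forall>x\<in>Q. f x \<in> \<Gamma> x)"
      by (rule IH) (use Q finQ finI fin\<Gamma> hall in \<open>auto intro: psubset_card_mono\<close>)
    then obtain f where f: "inj_on f Q" "\<forall>x\<in>Q. f x \<in> \<Gamma> x" by blast
    have "\<exists>g. inj_on g (I - Q) \<and> (\<forall>x\<in>I - Q. g x \<in> \<Gamma> x - U)"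
    proof (rule IH)
      show "card (I - Q) < card I"
        using Q finI by (intro psubset_card_mono) auto
      fix P assume P: "P \<subseteq> I - Q"
      have finP: "finite P" using P finI finite_subset by blast
      have "card P + card Q = card (P \<union> Q)"
        using P finP finQ by (subst card_Un_disjoint) auto
      also have "\<dots> \<le> card (\<Union>x\<in>P \<union> Q. \<Gamma> x)" using P Q by (intro hall) auto
      also have "(\<Union>x\<in>P \<union> Q. \<Gamma> x) = (\<Union>x\<in>P. \<Gamma> x - U) \<union> U" by (auto simp: U_def)
      also have "card \<dots> \<le> card (\<Union>x\<in>P. \<Gamma> x - U) + card U" by (rule card_Un_le)
      finally show "card P \<le> card (\<Union>x\<in>P. \<Gamma> x - U)" using Q(3) by (simp add: U_def)
    qed (use finI fin\<Gamma> in auto)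
    then obtain g where g: "inj_on g (I - Q)" "\<forall>x\<in>I - Q. g x \<in> \<Gamma> x - U" by blast
    have "f x \<in> U" if "x \<in> Q" for x using f that by (auto simp: U_def)
    then have "f ` Q \<inter> g ` (I - Q) = {}" using g(2) by fastforce
    then have "inj_on (\<lambda>x. if x \<in> Q then f x else g x) (Q \<union> (I - Q))"
      using f(1) g(1) by (intro inj_on_disjoint_Un)
    moreover have "Q \<union> (I - Q) = I" using Q(1) by blast
    ultimately have "inj_on (\<lambda>x. if x \<in> Q then f x else g x) I" by simp
    then show ?thesis using f(2) g(2)
      by (intro exI[of _ "\<lambda>x. if x \<in> Q then f x else g x"]) auto
  next
    case False
    show ?thesis
    proof (cases "I = {}")
      case False
      then obtain z where z: "z \<in> I" by blast
      have "card {z} \<le> card (\<Union>x\<in>{z}. \<Gamma> x)" using z by (intro hall) auto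
      then obtain u where u: "u \<in> \<Gamma> z" by (cases "\<Gamma> z = {}") auto
      have "\<exists>g. inj_on g (I - {z}) \<and> (\<forall>x\<in>I - {z}. g x \<in> \<Gamma> x - {u})"
      proof (rule IH)
        show "card (I - {z}) < card I" using z finI by (intro psubset_card_mono) auto
        fix P assume P: "P \<subseteq> I - {z}"
        show "card P \<le> card (\<Union>x\<in>P. \<Gamma> x - {u})"
        proof (cases "P = {}")
          case False
          have "card P \<noteq> card (\<Union>x\<in>P. \<Gamma> x)"
          proof -
            have "P \<subset> I" using P z by blast
            then show ?thesis
              using \<open>\<nexists>Q. Q \<subset> I \<and> Q \<noteq> {} \<and> card (\<Union>x\<in>Q. \<Gamma> x) = card Q\<close> False by metis
          qed
          moreover have "card P \<le> card (\<Union>x\<in>P. \<Gamma> x)" using P by (intro hall) auto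
          moreover have "card (\<Union>x\<in>P. \<Gamma> x) - 1 \<le> card ((\<Union>x\<in>P. \<Gamma> x) - {u})"
            using diff_card_le_card_Diff[of "{u}" "\<Union>x\<in>P. \<Gamma> x"] by simp
          ultimately have "card P \<le> card ((\<Union>x\<in>P. \<Gamma> x) - {u})" by linarith
          also have "(\<Union>x\<in>P. \<Gamma> x) - {u} = (\<Union>x\<in>P. \<Gamma> x - {u})" by blast
          finally show ?thesis .
        qed simp
      qed (use finI fin\<Gamma> in auto)
      then obtain g where g: "inj_on g (I - {z})" "\<forall>x\<in>I - {z}. g x \<in> \<Gamma> x - {u}" by blast
      have "inj_on (g(z := u)) I"
        using g by (auto simp: inj_on_def)
      then show ?thesis using g(2) u by (intro exI[of _ "g(z := u)"]) auto
    qed simp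
  qed
qed

definition matching_within :: "('g \<times> 'p) set \<Rightarrow> 'g set \<Rightarrow> ('g \<times> 'p) set \<Rightarrow> bool" where
  "matching_within R X Z \<longleftrightarrow> Z \<subseteq> R \<inter> X \<times> UNIV \<and> inj_on fst Z \<and> inj_on snd Z"

lemma sum_card_Int_partition:
  assumes "partition_among S B A" "finite S" "finite B"
  shows "(\<Sum>i\<in>S. card (G \<inter> A i)) = card (G \<inter> B)"
proof -
  have "card (\<Union>i\<in>S. G \<inter> A i) = (\<Sum>i\<in>S. card (G \<inter> A i))"
  proof (rule card_UN_disjoint[OF assms(2)])
    show "\<forall>i\<in>S. finite (G \<inter> A i)"
      using assms by (auto simp: partition_among_def intro: finite_subset[of _ B])
    show "\<forall>i\<in>S. \<forall>j\<in>S. i \<noteq> j \<longrightarrow> (G \<inter> A i) \<inter> (G \<inter> A j) = {}"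
      using assms(1) unfolding partition_among_def by blast
  qed
  moreover have "(\<Union>i\<in>S. G \<inter> A i) = G \<inter> B"
    using assms by (auto simp: partition_among_def)
  ultimately show ?thesis by simp
qed

text \<open>Adding, for each agent with position set J and demand d, exactly |J| - d dummy goods that fit
  all positions in J turns the lower bound d on the number of filled positions into the
  requirement that every position be filled, to which Hall's theorem applies.\<close>

lemma demands_met_if_hall:
  fixes R :: "'n \<Rightarrow> ('g \<times> 'p) set" and d :: "'n \<Rightarrow> nat"
  assumes N: "finite N" and M: "finite M" and ne: "N = {} \<Longrightarrow> M = {}"
    and R: "\<And>i. i \<in> N \<Longrightarrow> finite (R i) \<and> R i \<subseteq> M \<times> UNIV"
    and dJ: "\<And>i. i \<in> N \<Longrightarrow> d i \<le> card (snd ` R i)"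
    and hall: "\<And>P. (\<And>i. i \<in> N \<Longrightarrow> P i \<subseteq> snd ` R i) \<Longrightarrow>
      (\<Sum>i\<in>N. d i - (card (snd ` R i) - card (P i))) \<le> card {g. \<exists>i\<in>N. \<exists>j\<in>P i. (g, j) \<in> R i}"
  shows "\<exists>B. partition_among N M B \<and> (\<forall>i\<in>N. \<exists>Z. matching_within (R i) (B i) Z \<and> d i \<le> card Z)"
proof -
  define J where "J i = snd ` R i" for i
  have J: "finite (J i)" if "i \<in> N" for i using R[OF that] by (simp add: J_def)
  define \<Gamma> :: "'n \<times> 'p \<Rightarrow> ('g + 'n \<times> nat) set" where
    "\<Gamma> = (\<lambda>(i, j). Inl ` {g. (g, j) \<in> R i} \<union> Inr ` ({i} \<times> {..<card (J i) - d i}))"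
  have "\<exists>f. inj_on f (Sigma N J) \<and> (\<forall>x\<in>Sigma N J. f x \<in> \<Gamma> x)"
  proof (rule hall_marriage)
    show "finite (Sigma N J)" using N J by auto
    fix x assume "x \<in> Sigma N J"
    then obtain i j where x: "x = (i, j)" "i \<in> N" by auto
    have "{g. (g, j) \<in> R i} \<subseteq> fst ` R i" by force
    then have "finite {g. (g, j) \<in> R i}"
      using R[OF x(2)] by (meson finite_imageI finite_subset)
    then show "finite (\<Gamma> x)" by (simp add: \<Gamma>_def x)
  next
    fix P assume P: "P \<subseteq> Sigma N J"
    define p where "p i = {j. (i, j) \<in> P}" for i
    have p: "p i \<subseteq> J i" "finite (p i)" if "i \<in> N" for i
      using P J[OF that] by (auto simp: p_def intro: finite_subset[of _ "J i"])
    define G where "G = {g. \<exists>i\<in>N. \<exists>j\<in>p i. (g, j) \<in> R i}"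
    have "G \<subseteq> M" using R by (fastforce simp: G_def)
    then have finG: "finite G" using M finite_subset by blast
    define N' where "N' = {i\<in>N. p i \<noteq> {}}"
    have finN': "finite N'" using N by (simp add: N'_def)
    define D where "D = (SIGMA i:N'. {..<card (J i) - d i})"
    have "P = Sigma N' p" using P by (auto simp: N'_def p_def)
    then have "card P = (\<Sum>i\<in>N'. card (p i))"
      using finN' p by (simp add: N'_def)
    also have "\<dots> \<le> (\<Sum>i\<in>N'. (d i - (card (J i) - card (p i))) + (card (J i) - d i))"
    proof (rule sum_mono)
      fix i assume "i \<in> N'"
      then have "card (p i) \<le> card (J i)" using p J by (intro card_mono) (auto simp: N'_def)
      then show "card (p i) \<le> (d i - (card (J i) - card (p i))) + (card (J i) - d i)" by linarith
    qed
    also have "\<dots> = (\<Sum>i\<in>N'. d i - (card (J i) - card (p i))) + card D"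
      using finN' by (simp add: sum.distrib D_def)
    also have "(\<Sum>i\<in>N'. d i - (card (J i) - card (p i))) \<le> (\<Sum>i\<in>N. d i - (card (J i) - card (p i)))"
      using N by (intro sum_mono2) (auto simp: N'_def)
    also have "\<dots> \<le> card G"
      unfolding G_def J_def by (rule hall) (use p in \<open>auto simp: J_def\<close>)
    also have "card G + card D = card (Inl ` G \<union> Inr ` D)"
      using finG finN' by (subst card_Un_disjoint) (auto simp: card_image D_def)
    also have "\<dots> \<le> card (\<Union>x\<in>P. \<Gamma> x)"
    proof (rule card_mono)
      show "finite (\<Union>x\<in>P. \<Gamma> x)"
      proof (rule finite_subset)
        show "(\<Union>x\<in>P. \<Gamma> x) \<subseteq> Inl ` M \<union> Inr ` (SIGMA i:N. {..<card (J i) - d i})"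
          using P R by (fastforce simp: \<Gamma>_def)
      qed (use M N in auto)
      show "Inl ` G \<union> Inr ` D \<subseteq> (\<Union>x\<in>P. \<Gamma> x)"
        by (force simp: \<Gamma>_def G_def D_def N'_def p_def)
    qed
    finally show "card P \<le> card (\<Union>x\<in>P. \<Gamma> x)" by simp
  qed
  then obtain f where f: "inj_on f (Sigma N J)" "\<And>x. x \<in> Sigma N J \<Longrightarrow> f x \<in> \<Gamma> x" by blast
  define Z where "Z i = {(g, j). j \<in> J i \<and> f (i, j) = Inl g}" for i
  have ZR: "Z i \<subseteq> R i" if "i \<in> N" for i
    using f(2) that by (fastforce simp: Z_def \<Gamma>_def)
  have inj1: "inj_on fst (Z i)" if "i \<in> N" for i
    using f(1) that by (auto simp: inj_on_def Z_def)
  have inj2: "inj_on snd (Z i)" for i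
    by (auto simp: inj_on_def Z_def)
  have cardZ: "d i \<le> card (Z i)" if i: "i \<in> N" for i
  proof -
    define Q where "Q = J i - snd ` Z i"
    have "(\<lambda>j. f (i, j)) ` Q \<subseteq> Inr ` ({i} \<times> {..<card (J i) - d i})"
    proof
      fix y assume "y \<in> (\<lambda>j. f (i, j)) ` Q"
      then obtain j where j: "y = f (i, j)" "j \<in> J i" "j \<notin> snd ` Z i" by (auto simp: Q_def)
      have "y \<noteq> Inl g" for g using j by (force simp: Z_def)
      then show "y \<in> Inr ` ({i} \<times> {..<card (J i) - d i})"
        using f(2)[of "(i, j)"] j i by (auto simp: \<Gamma>_def)
    qed
    moreover have "inj_on (\<lambda>j. f (i, j)) Q"
      using f(1) i by (auto simp: inj_on_def Q_def)
    ultimately have "card Q \<le> card (Inr ` ({i} \<times> {..<card (J i) - d i}) :: ('g + 'n \<times> nat) set)"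
      by (intro card_inj_on_le) auto
    then have "card Q \<le> card (J i) - d i" by (simp add: card_image)
    moreover have "card (J i) - card (snd ` Z i) \<le> card Q"
      unfolding Q_def by (rule diff_card_le_card_Diff)
        (use J[OF i] in \<open>auto simp: Z_def intro: finite_subset[of _ "J i"]\<close>)
    ultimately show ?thesis using dJ[OF i] inj2[of i] by (simp add: card_image J_def)
  qed
  have disj: "fst ` Z i \<inter> fst ` Z k = {}" if "i \<in> N" "k \<in> N" "i \<noteq> k" for i k
    using f(1) that by (fastforce simp: Z_def inj_on_def)
  have ZM: "fst ` Z i \<subseteq> M" if "i \<in> N" for i using ZR[OF that] R[OF that] by fastforce
  have "\<exists>B. partition_among N M B \<and> (\<forall>i\<in>N. fst ` Z i \<subseteq> B i)"
  proof (cases "N = {}")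
    case True
    then show ?thesis using ne by (simp add: partition_among_def)
  next
    case False
    then obtain k where k: "k \<in> N" by blast
    define B where "B i = (if i = k then M - (\<Union>i\<in>N - {k}. fst ` Z i) else fst ` Z i)" for i
    have "partition_among N M B"
      unfolding partition_among_def
    proof (intro conjI ballI impI)
      show "B i \<subseteq> M" if "i \<in> N" for i using ZM[OF that] by (auto simp: B_def)
      show "B i \<inter> B l = {}" if "i \<in> N" "l \<in> N" "i \<noteq> l" for i l
        using disj[OF that] that by (auto simp: B_def)
      show "(\<Union>i\<in>N. B i) = M"
      proof (intro antisym subsetI)
        fix g assume "g \<in> M"
        then show "g \<in> (\<Union>i\<in>N. B i)"
          using k by (cases "g \<in> (\<Union>i\<in>N - {k}. fst ` Z i)") (auto simp: B_def)
      qed (use ZM in \<open>auto simp: B_def split: if_splits\<close>)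
    qed
    moreover have "fst ` Z i \<subseteq> B i" if "i \<in> N" for i
      using disj[OF that] ZM[OF that] that by (auto simp: B_def)
    ultimately show ?thesis by blast
  qed
  then obtain B where B: "partition_among N M B" "\<And>i. i \<in> N \<Longrightarrow> fst ` Z i \<subseteq> B i" by blast
  have "matching_within (R i) (B i) (Z i)" if "i \<in> N" for i
    unfolding matching_within_def using ZR[OF that] B(2)[OF that] inj1[OF that] inj2
    by (auto simp: mem_Times_iff)
  then show ?thesis using B(1) cardZ by blast
qed

lemma demands_met_if_balanced:
  fixes R :: "'n \<Rightarrow> ('g \<times> 'p) set" and d :: "'n \<Rightarrow> nat" and w :: "'c \<Rightarrow> real"
  assumes N: "finite N" and M: "finite M" and E: "partition_among N M E" and C: "finite C"
    and R: "\<And>i. i \<in> N \<Longrightarrow> finite (R i) \<and> R i \<subseteq> M \<times> UNIV"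
    and S: "\<And>c. c \<in> C \<Longrightarrow> S c \<subseteq> N"
    and A: "\<And>c. c \<in> C \<Longrightarrow> partition_among (S c) (\<Union>i\<in>S c. E i) (A c)"
    and w0: "\<And>c. c \<in> C \<Longrightarrow> 0 \<le> w c"
    and w1: "\<And>i. i \<in> N \<Longrightarrow> 1 \<le> (\<Sum>c | c \<in> C \<and> i \<in> S c. w c)"
    and w2: "\<And>i. i \<in> N \<Longrightarrow> (\<Sum>c | c \<in> C \<and> i \<in> S c. w c) \<le> 1 + \<delta>"
    and \<delta>: "\<delta> * card M < 1" "0 \<le> \<delta>"
    and met: "\<And>c i. c \<in> C \<Longrightarrow> 0 < w c \<Longrightarrow> i \<in> S c \<Longrightarrow>
      \<exists>Z. matching_within (R i) (A c i) Z \<and> d i \<le> card Z"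
  shows "\<exists>B. partition_among N M B \<and> (\<forall>i\<in>N. \<exists>Z. matching_within (R i) (B i) Z \<and> d i \<le> card Z)"
proof (rule demands_met_if_hall[OF N M _ R])
  show "N = {} \<Longrightarrow> M = {}" using E by (simp add: partition_among_def)
next
  fix i assume i: "i \<in> N"
  have "\<exists>c\<in>C. i \<in> S c \<and> 0 < w c"
  proof (rule ccontr)
    assume "\<not> ?thesis"
    then have "(\<Sum>c | c \<in> C \<and> i \<in> S c. w c) \<le> 0" by (intro sum_nonpos) force
    then show False using w1[OF i] by simp
  qed
  then obtain c Z where "matching_within (R i) (A c i) Z" "d i \<le> card Z" using met by blast
  moreover from this have "card Z = card (snd ` Z)" "snd ` Z \<subseteq> snd ` R i"
    by (auto simp: matching_within_def card_image)
  ultimately show "d i \<le> card (snd ` R i)"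
    using R[OF i] by (metis card_mono finite_imageI le_trans)
next
  fix P assume P: "\<And>i. i \<in> N \<Longrightarrow> P i \<subseteq> snd ` R i"
  define G where "G = {g. \<exists>i\<in>N. \<exists>j\<in>P i. (g, j) \<in> R i}"
  have GM: "G \<subseteq> M" using R by (fastforce simp: G_def)
  then have finG: "finite G" using M finite_subset by blast
  define a where "a i = d i - (card (snd ` R i) - card (P i))" for i
  have a_le: "a i \<le> card (G \<inter> A c i)" if c: "c \<in> C" "0 < w c" and i: "i \<in> S c" for c i
  proof -
    have iN: "i \<in> N" using S c i by blast
    obtain Z where Z: "matching_within (R i) (A c i) Z" "d i \<le> card Z" using met c i by blast
    define Z1 where "Z1 = {z\<in>Z. snd z \<in> P i}"
    define Z2 where "Z2 = {z\<in>Z. snd z \<notin> P i}"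
    have finJ: "finite (snd ` R i)" using R[OF iN] by simp
    have "card Z \<le> card Z1 + card Z2"
    proof -
      have "Z = Z1 \<union> Z2" by (auto simp: Z1_def Z2_def)
      then show ?thesis using card_Un_le by metis
    qed
    moreover have "card Z2 \<le> card (snd ` R i) - card (P i)"
    proof -
      have "card Z2 = card (snd ` Z2)" using Z
        by (subst card_image) (auto simp: Z2_def matching_within_def intro: inj_on_subset)
      also have "\<dots> \<le> card (snd ` R i - P i)"
        using Z finJ by (intro card_mono) (auto simp: Z2_def matching_within_def)
      also have "\<dots> = card (snd ` R i) - card (P i)"
        using P[OF iN] finJ by (intro card_Diff_subset) (auto intro: finite_subset)
      finally show ?thesis .
    qed
    moreover have "card Z1 \<le> card (G \<inter> A c i)"
    proof -
      have "card Z1 = card (fst ` Z1)" using Z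
        by (subst card_image) (auto simp: Z1_def matching_within_def intro: inj_on_subset)
      also have "\<dots> \<le> card (G \<inter> A c i)"
        using Z finG iN by (intro card_mono) (fastforce simp: Z1_def matching_within_def G_def)+
      finally show ?thesis .
    qed
    ultimately show ?thesis using Z(2) by (simp add: a_def)
  qed
  have sum_le: "(\<Sum>i\<in>S c. a i) \<le> (\<Sum>i\<in>S c. card (G \<inter> E i))" if c: "c \<in> C" "0 < w c" for c
  proof -
    have finS: "finite (S c)" using S[OF c(1)] N finite_subset by blast
    have EM: "(\<Union>i\<in>S c. E i) \<subseteq> M" using E S[OF c(1)] by (auto simp: partition_among_def)
    then have finE: "finite (\<Union>i\<in>S c. E i)" using M finite_subset by blast
    have "partition_among (S c) (\<Union>i\<in>S c. E i) E"
      using E S[OF c(1)] unfolding partition_among_def by (intro conjI) blast+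
    then have "(\<Sum>i\<in>S c. card (G \<inter> E i)) = (\<Sum>i\<in>S c. card (G \<inter> A c i))"
      using sum_card_Int_partition A[OF c(1)] finS finE by metis
    then show ?thesis using sum_mono[of "S c" a "\<lambda>i. card (G \<inter> A c i)"] a_le[OF c] by simp
  qed
  have swap: "(\<Sum>i\<in>N. real (x i) * (\<Sum>c | c \<in> C \<and> i \<in> S c. w c)) = (\<Sum>c\<in>C. w c * real (\<Sum>i\<in>S c. x i))"
    for x :: "'n \<Rightarrow> nat"
  proof -
    have "(\<Sum>i\<in>N. real (x i) * (\<Sum>c | c \<in> C \<and> i \<in> S c. w c))
        = (\<Sum>i\<in>N. \<Sum>c | c \<in> C \<and> i \<in> S c. w c * real (x i))"
      by (simp add: sum_distrib_left mult.commute)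
    also have "\<dots> = (\<Sum>c\<in>C. \<Sum>i | i \<in> N \<and> i \<in> S c. w c * real (x i))"
      using N C by (rule sum.swap_restrict)
    also have "\<dots> = (\<Sum>c\<in>C. \<Sum>i\<in>S c. w c * real (x i))"
      using S by (intro sum.cong refl) auto
    finally show ?thesis by (simp add: sum_distrib_left)
  qed
  have "real (\<Sum>i\<in>N. a i) \<le> (\<Sum>i\<in>N. real (a i) * (\<Sum>c | c \<in> C \<and> i \<in> S c. w c))"
    unfolding of_nat_sum by (rule sum_mono) (use w1 in \<open>simp add: mult_le_cancel_left1\<close>)
  also have "\<dots> \<le> (\<Sum>c\<in>C. w c * real (\<Sum>i\<in>S c. card (G \<inter> E i)))"
    unfolding swap
  proof (rule sum_mono)
    fix c assume c: "c \<in> C"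
    show "w c * real (\<Sum>i\<in>S c. a i) \<le> w c * real (\<Sum>i\<in>S c. card (G \<inter> E i))"
      using sum_le[OF c] w0[OF c] by (cases "w c = 0") (auto intro!: mult_left_mono simp del: of_nat_sum)
  qed
  also have "\<dots> = (\<Sum>i\<in>N. real (card (G \<inter> E i)) * (\<Sum>c | c \<in> C \<and> i \<in> S c. w c))"
    by (rule swap[symmetric])
  also have "\<dots> \<le> (\<Sum>i\<in>N. real (card (G \<inter> E i)) * (1 + \<delta>))"
    using w2 by (intro sum_mono mult_left_mono) auto
  also have "\<dots> = real (\<Sum>i\<in>N. card (G \<inter> E i)) * (1 + \<delta>)"
    by (simp add: sum_distrib_right)
  also have "(\<Sum>i\<in>N. card (G \<inter> E i)) = card G"
    using sum_card_Int_partition[OF E N M, of G] GM by (simp add: Int_absorb2)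
  also have "real (card G) * (1 + \<delta>) \<le> real (card G) + \<delta> * real (card M)"
    using \<delta>(2) card_mono[OF M GM] by (simp add: algebra_simps mult_left_mono)
  finally have "real (\<Sum>i\<in>N. a i) < real (card G) + 1" using \<delta>(1) by linarith
  then have "(\<Sum>i\<in>N. a i) \<le> card G" by linarith
  then show "(\<Sum>i\<in>N. d i - (card (snd ` R i) - card (P i))) \<le> card {g. \<exists>i\<in>N. \<exists>j\<in>P i. (g, j) \<in> R i}"
    by (simp add: a_def G_def)
qed auto

section \<open>Nonemptiness of the weak core\<close>

lemma binary_assignment_valuation_matching:
  assumes M: "finite M" and v: "binary_assignment_valuation M v"
  shows "\<exists>(R :: ('g \<times> nat) set) \<nu>. finite R \<and> R \<subseteq> M \<times> UNIV \<and>
    (\<forall>X. X \<subseteq> M \<longrightarrow> v X = real (\<nu> X) \<and> (\<exists>Z. matching_within R X Z \<and> \<nu> X \<le> card Z) \<and>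
      (\<forall>Z. matching_within R X Z \<longrightarrow> card Z \<le> \<nu> X))"
proof -
  obtain J :: "nat set" and \<alpha> where J: "finite J"
    and \<alpha>: "\<And>g j. g \<in> M \<Longrightarrow> j \<in> J \<Longrightarrow> \<alpha> g j \<in> {0, 1 :: real}"
    and vX: "\<And>X. X \<subseteq> M \<Longrightarrow> v X = Max {(\<Sum>(g,j)\<in>Z. \<alpha> g j) | Z. is_assignment X J Z}"
    using v unfolding binary_assignment_valuation_def by blast
  define R where "R = {(g, j) \<in> M \<times> J. \<alpha> g j = 1}"
  have R: "finite R" "R \<subseteq> M \<times> UNIV"
    using M J by (auto simp: R_def intro: finite_subset[of _ "M \<times> J"])
  have val: "(\<Sum>(g,j)\<in>Z. \<alpha> g j) = real (card (Z \<inter> R))" if "Z \<subseteq> M \<times> J" for Z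
  proof -
    have fin: "finite Z" using that M J finite_subset by blast
    have "(\<Sum>(g,j)\<in>Z. \<alpha> g j) = (\<Sum>z\<in>Z. if z \<in> R then 1 else 0)"
      using that \<alpha> by (intro sum.cong) (fastforce simp: R_def)+
    also have "\<dots> = real (card (Z \<inter> R))" using fin by (simp add: sum.If_cases)
    finally show ?thesis .
  qed
  define V where "V X = {(\<Sum>(g,j)\<in>Z. \<alpha> g j) | Z. is_assignment X J Z}" for X
  have finV: "finite (V X)" if "X \<subseteq> M" for X
  proof -
    have "V X \<subseteq> (\<lambda>Z. \<Sum>(g,j)\<in>Z. \<alpha> g j) ` Pow (M \<times> J)"
      using that by (fastforce simp: V_def is_assignment_def)
    then show ?thesis using M J by (auto intro: finite_subset)
  qed
  have "is_assignment X J {}" for X by (simp add: is_assignment_def)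
  then have neV: "V X \<noteq> {}" for X unfolding V_def by blast
  have attained: "\<exists>Z. matching_within R X Z \<and> v X = real (card Z)" if X: "X \<subseteq> M" for X
  proof -
    have "v X \<in> V X" using Max_in[OF finV[OF X] neV] vX[OF X] by (simp add: V_def)
    then obtain Z where Z: "is_assignment X J Z" "v X = (\<Sum>(g,j)\<in>Z. \<alpha> g j)"
      by (auto simp: V_def)
    then have "Z \<subseteq> M \<times> J" using X by (auto simp: is_assignment_def)
    then have "v X = real (card (Z \<inter> R))" using Z val by simp
    moreover have "matching_within R X (Z \<inter> R)"
      using Z(1) unfolding matching_within_def is_assignment_def by (auto intro: inj_on_subset)
    ultimately show ?thesis by blast
  qed
  define \<nu> where "\<nu> X = nat \<lfloor>v X\<rfloor>" for X
  have v\<nu>: "v X = real (\<nu> X)" if "X \<subseteq> M" for X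
    using attained[OF that] by (auto simp: \<nu>_def)
  have \<nu>1: "\<exists>Z. matching_within R X Z \<and> \<nu> X \<le> card Z" if "X \<subseteq> M" for X
    using attained[OF that] v\<nu>[OF that] by auto
  have \<nu>2: "card Z \<le> \<nu> X" if X: "X \<subseteq> M" and Z: "matching_within R X Z" for X Z
  proof -
    from X Z have "is_assignment X J Z"
      by (auto simp: matching_within_def is_assignment_def R_def)
    then have "(\<Sum>(g,j)\<in>Z. \<alpha> g j) \<le> v X"
      unfolding vX[OF X] using finV[OF X] by (intro Max_ge) (auto simp: V_def)
    moreover have "Z \<inter> R = Z" "Z \<subseteq> M \<times> J" using Z by (auto simp: matching_within_def R_def)
    ultimately show ?thesis using val[of Z] v\<nu>[OF X] by simp
  qed
  show ?thesis
    by (rule exI[of _ R], rule exI[of _ \<nu>]) (simp add: R v\<nu> \<nu>1 \<nu>2)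
qed

theorem mainTheorem10:
  fixes N :: "'n set" and M :: "'g set"
    and E :: "'n \<Rightarrow> 'g set" and v :: "'n \<Rightarrow> 'g set \<Rightarrow> real"
  assumes "finite N" and "finite M"
    and "partition_among N M E"
    and "\<forall>i\<in>N. binary_assignment_valuation M (v i)"
  shows "\<exists>A. weak_core N M E v A"
proof -
  note N = assms(1) and M = assms(2) and E = assms(3)
  define represents where "represents i R \<nu> \<longleftrightarrow> finite R \<and> R \<subseteq> M \<times> UNIV \<and>
      (\<forall>X. X \<subseteq> M \<longrightarrow> v i X = real (\<nu> X) \<and> (\<exists>Z. matching_within R X Z \<and> \<nu> X \<le> card Z) \<and>
        (\<forall>Z. matching_within R X Z \<longrightarrow> card Z \<le> \<nu> X))"
    for i and R :: "('g \<times> nat) set" and \<nu>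
  have "\<exists>R \<nu>. represents i R \<nu>" if "i \<in> N" for i
    unfolding represents_def using assms(4) that
    by (intro binary_assignment_valuation_matching[OF M]) blast
  then obtain R \<nu> where rep: "\<And>i. i \<in> N \<Longrightarrow> represents i (R i) (\<nu> i)" by metis
  have R: "\<And>i. i \<in> N \<Longrightarrow> finite (R i) \<and> R i \<subseteq> M \<times> UNIV"
    and v: "\<And>i X. i \<in> N \<Longrightarrow> X \<subseteq> M \<Longrightarrow> v i X = real (\<nu> i X)"
    and \<nu>1: "\<And>i X. i \<in> N \<Longrightarrow> X \<subseteq> M \<Longrightarrow> \<exists>Z. matching_within (R i) X Z \<and> \<nu> i X \<le> card Z"
    and \<nu>2: "\<And>i X Z. i \<in> N \<Longrightarrow> X \<subseteq> M \<Longrightarrow> matching_within (R i) X Z \<Longrightarrow> card Z \<le> \<nu> i X"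
    using rep unfolding represents_def by simp_all
  have EM: "(\<Union>i\<in>S. E i) \<subseteq> M" if "S \<subseteq> N" for S
    using E that by (auto simp: partition_among_def)
  define C where "C = (SIGMA S : Pow N - {{}}. {A \<in> S \<rightarrow>\<^sub>E Pow M. partition_among S (\<Union>i\<in>S. E i) A})"
  have finC: "finite C"
    unfolding C_def using N M
    by (intro finite_SigmaI finite_Diff) (auto intro!: finite_PiE intro: finite_subset)
  have C: "fst c \<subseteq> N" "fst c \<noteq> {}" "partition_among (fst c) (\<Union>i\<in>fst c. E i) (snd c)"
    "\<And>i. i \<in> fst c \<Longrightarrow> i \<in> N \<and> snd c i \<subseteq> M" if "c \<in> C" for c
    using that by (fastforce simp: C_def PiE_iff)+
  have CI: "(S, restrict A S) \<in> C"
    if "S \<subseteq> N" "S \<noteq> {}" "partition_among S (\<Union>i\<in>S. E i) A" for S A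
  proof -
    have "partition_among S (\<Union>i\<in>S. E i) (restrict A S)"
      using that(3) by (auto simp: partition_among_def)
    moreover have "A i \<subseteq> M" if "i \<in> S" for i
      using \<open>partition_among S (\<Union>i\<in>S. E i) A\<close> EM[OF \<open>S \<subseteq> N\<close>] that
      unfolding partition_among_def by blast
    ultimately show ?thesis using that by (auto simp: C_def)
  qed
  define \<delta> where "\<delta> = 1 / (real (card M) + 2)"
  have \<delta>: "0 < \<delta>" "\<delta> < 1" "\<delta> * card M < 1" by (auto simp: \<delta>_def)
  have single: "\<exists>c\<in>C. fst c = {i} \<and> 0 \<le> v i (snd c i)" if i: "i \<in> N" for i
  proof -
    have "({i}, restrict E {i}) \<in> C" using i by (intro CI) (auto simp: partition_among_def)
    moreover have "E i \<subseteq> M" using EM[of "{i}"] i by simp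
    ultimately show ?thesis using v[OF i, of "E i"] by force
  qed
  obtain t w where w0: "\<And>c. c \<in> C \<Longrightarrow> 0 \<le> w c"
    and w1: "\<And>i. i \<in> N \<Longrightarrow> 1 \<le> (\<Sum>c | c \<in> C \<and> i \<in> fst c. w c)"
    and w2: "\<And>i. i \<in> N \<Longrightarrow> (\<Sum>c | c \<in> C \<and> i \<in> fst c. w c) \<le> 1 + \<delta>"
    and t1: "\<And>c i. c \<in> C \<Longrightarrow> 0 < w c \<Longrightarrow> i \<in> fst c \<Longrightarrow> t i < v i (snd c i)"
    and t2: "\<And>c. c \<in> C \<Longrightarrow> \<exists>i\<in>fst c. v i (snd c i) < t i + 1"
    by (rule undominated_levels_with_balanced_weights
        [OF N finC _ _ \<delta>(1,2), of fst "\<lambda>c i. v i (snd c i)"])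
      (use C single in auto)
  define d where "d i = nat \<lceil>t i\<rceil>" for i
  have "\<exists>B. partition_among N M B \<and> (\<forall>i\<in>N. \<exists>Z. matching_within (R i) (B i) Z \<and> d i \<le> card Z)"
  proof (rule demands_met_if_balanced[OF N M E finC R C(1) C(3) w0 w1 w2 \<delta>(3)])
    fix c i assume c: "c \<in> C" "0 < w c" "i \<in> fst c"
    note i = C(4)[OF c(1,3)]
    have "t i < real (\<nu> i (snd c i))" using t1[OF c] v i by simp
    then have "d i \<le> \<nu> i (snd c i)" unfolding d_def by linarith
    then show "\<exists>Z. matching_within (R i) (snd c i) Z \<and> d i \<le> card Z"
      using \<nu>1 i le_trans by blast
  qed (use \<delta> in auto)
  then obtain B where B: "partition_among N M B"
    and met: "\<And>i. i \<in> N \<Longrightarrow> \<exists>Z. matching_within (R i) (B i) Z \<and> d i \<le> card Z"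
    by blast
  have BM: "B i \<subseteq> M" if "i \<in> N" for i using B that by (auto simp: partition_among_def)
  have d_le: "d i \<le> \<nu> i (B i)" if "i \<in> N" for i
    using met[OF that] \<nu>2[OF that BM[OF that]] le_trans by blast
  have False if "strongly_blocking N E v B S" for S
  proof -
    obtain A where S: "S \<noteq> {}" "S \<subseteq> N" and A: "partition_among S (\<Union>i\<in>S. E i) A"
      and better: "\<And>i. i \<in> S \<Longrightarrow> v i (B i) < v i (A i)"
      using \<open>strongly_blocking N E v B S\<close> unfolding strongly_blocking_def by blast
    obtain i where i: "i \<in> S" "v i (A i) < t i + 1"
      using t2[OF CI[OF S(2,1) A]] by auto
    have iN: "i \<in> N" using i S by blast
    have "A i \<subseteq> M" using A EM[OF S(2)] i unfolding partition_among_def by blast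
    then have "\<nu> i (B i) < \<nu> i (A i)" "real (\<nu> i (A i)) < t i + 1"
      using better[OF i(1)] i(2) v[OF iN] BM[OF iN] by auto
    then show False using d_le[OF iN] unfolding d_def by linarith
  qed
  then show ?thesis using B unfolding weak_core_def by blast
qed

end
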